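(* Let $T\in B(H)$, and let $(\lambda_n)_{n=1}^\infty$ be a sequence in $\mathrm{Int}\, W_e(T)$ such that $\sum_{n=1}^\infty \mathrm{dist}\{\lambda_n,\partial W_e(T)\}=\infty$. Then for every $K\in\mathbb N$ there exists an orthonormal basis $(u_n)_{n=1}^\infty$ in $H$ such that $$\langle Tu_n,u_n\rangle=\lambda_n \quad\text{for all } n\in\mathbb N,$$ and $$\langle Tu_n,u_j\rangle=0 \quad\text{for all } n,j\in\mathbb N \text{ with } 1\le |n-j|\le K.$$
   Context: $H$ is a separable infinite-dimensional complex Hilbert space and $B(H)$ is the space of bounded linear operators on $H$. $\mathbb N=\{1,2,\dots\}$. The essential numerical range $W_e(T)\subset\mathbb C$ of $T\in B(H)$ is the set of all $\lambda\in\mathbb C$ for which there exists an orthonormal sequence $(e_n)_{n=1}^\infty\subset H$ with $\langle Te_n,e_n\rangle\to\lambda$ as $n\to\infty$ (it is a nonempty, compact, convex set). $\mathrm{Int}\,W_e(T)$ and $\partial W_e(T)$ are its interior and boundary in $\mathbb C$, and $\mathrm{dist}\{\lambda,A\}=\inf_{a\in A}|\lambda-a|$. *)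

theory Defs
  imports "HOL-Analysis.Analysis"
begin

class complex_vector = real_vector +
  fixes scaleC :: "complex \<Rightarrow> 'a \<Rightarrow> 'a" (infixr \<open>*\<^sub>C\<close> 75)
  assumes scaleC_add_right: "a *\<^sub>C (x + y) = a *\<^sub>C x + a *\<^sub>C y"
    and scaleC_add_left: "(a + b) *\<^sub>C x = a *\<^sub>C x + b *\<^sub>C x"
    and scaleC_scaleC: "a *\<^sub>C (b *\<^sub>C x) = (a * b) *\<^sub>C x"
    and scaleC_one: "1 *\<^sub>C x = x"
    and scaleR_scaleC: "r *\<^sub>R x = complex_of_real r *\<^sub>C x"

global_interpretation complex_vector:
  vector_space "scaleC :: complex \<Rightarrow> 'a \<Rightarrow> 'a :: complex_vector"
  defines cspan = complex_vector.span
  by unfold_locales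
    (simp_all add: scaleC_add_right scaleC_add_left scaleC_scaleC scaleC_one)

text \<open>The inner product is linear in its first argument and conjugate linear in the second.\<close>

class complex_inner = complex_vector + real_normed_vector +
  fixes cinner :: "'a \<Rightarrow> 'a \<Rightarrow> complex"
  assumes cinner_commute: "cinner x y = cnj (cinner y x)"
    and cinner_add_left: "cinner (x + y) z = cinner x z + cinner y z"
    and cinner_scaleC_left: "cinner (a *\<^sub>C x) y = a * cinner x y"
    and cinner_ge_zero: "0 \<le> Re (cinner x x)"
    and cinner_eq_zero_iff: "cinner x x = 0 \<longleftrightarrow> x = 0"
    and norm_eq_sqrt_cinner: "norm x = sqrt (Re (cinner x x))"

class complex_hilbert = complex_inner + complete_space

instantiation complex :: complex_hilbert
begin

definition scaleC_complex :: "complex \<Rightarrow> complex \<Rightarrow> complex"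
  where "scaleC_complex a x = a * x"

definition cinner_complex :: "complex \<Rightarrow> complex \<Rightarrow> complex"
  where "cinner_complex x y = x * cnj y"

instance
  by standard
    (auto simp: scaleC_complex_def cinner_complex_def algebra_simps scaleR_conv_of_real
      cmod_def power2_eq_square)

end

definition bounded_clinear :: "('a :: complex_hilbert \<Rightarrow> 'a) \<Rightarrow> bool"
  where "bounded_clinear T \<longleftrightarrow>
    bounded_linear T \<and> (\<forall>c x. T (c *\<^sub>C x) = c *\<^sub>C T x)"

definition orthonormal_seq :: "(nat \<Rightarrow> 'a :: complex_hilbert) \<Rightarrow> bool"
  where "orthonormal_seq e \<longleftrightarrow> (\<forall>m n. cinner (e m) (e n) = (if m = n then 1 else 0))"

definition orthonormal_basis_seq :: "(nat \<Rightarrow> 'a :: complex_hilbert) \<Rightarrow> bool"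
  where "orthonormal_basis_seq u \<longleftrightarrow>
    orthonormal_seq u \<and> closure (cspan (range u)) = UNIV"

definition ess_num_range :: "('a :: complex_hilbert \<Rightarrow> 'a) \<Rightarrow> complex set"
  where "ess_num_range T =
    {l. \<exists>e. orthonormal_seq e \<and> (\<lambda>n. cinner (T (e n)) (e n)) \<longlonglongrightarrow> l}"

text \<open>Sequences indexed by the positive integers are rendered as functions on \<^typ>\<open>nat\<close>, with
  the index shifted by one.\<close>

end

theory Submission
  imports Defs
begin

text \<open>
  The basis is built one vector at a time, alternating between two kinds of steps.

  Every interior point of the essential numerical range is a value \<open>cinner (T v) v\<close> of a unit
  vector \<open>v\<close> for which both \<open>v\<close> and \<open>T v\<close> are orthogonal to any prescribed finite set
  (\<open>interior_ess_num_range_attained\<close>).  Approximate values come from the defining orthonormal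
  sequences, which become orthogonal to the finite set after a small correction.  Choosing four
  such vectors for the corners of a small square around the point, each orthogonal to the previous
  ones and to their images, makes the values of their combinations fill the convex hull of four
  perturbed corners, and this hull still contains the centre.  Choosing every \<open>u n\<close> in this way
  would give the prescribed diagonal and even kill all off-diagonal entries, but such a sequence
  need not be complete.

  For completeness, let \<open>r\<close> be the part of a vector \<open>y\<close> not yet captured by the previous \<open>u j\<close>, and
  let \<open>d\<close> be the distance from \<open>l n\<close> to the boundary.  One may choose \<open>u n\<close> with a component
  of squared length proportional to \<open>d\<close> in the direction of \<open>r\<close>: the rest of \<open>u n\<close> must then
  attain a slightly shifted value, and the shift stays below \<open>d\<close>, so that this value is
  still interior (\<open>unit_vector_capturing_residual\<close>).  Each such step multiplies
  \<open>(norm r)\<^sup>2\<close> by at most \<open>1 - \<gamma>\<close> with \<open>\<gamma>\<close> proportional to \<open>d\<close>, and as the sum of the distances diverges, the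
  residual tends to \<open>0\<close>.  All targets \<open>y\<close> of a dense sequence are treated in one construction,
  because a divergent series of bounded nonnegative terms splits into infinitely many divergent
  ones (\<open>divergent_split\<close>).

  The price of a capturing step is that \<open>r\<close> enters the off-diagonal entries of \<open>u n\<close>.  The \<open>K\<close>
  neighbouring entries vanish if capturing happens only at indices more than \<open>K\<close> apart, which
  a residue class modulo \<open>Suc K\<close> with divergent sum permits, and if the vectors chosen in between
  are orthogonal to \<open>r\<close> and \<open>T r\<close> and have images orthogonal to \<open>r\<close>.  This is consistent, since such vectors do not
  change the residual, so that the \<open>r\<close> of the next capturing step is already known to them
  (\<open>admissible_residual_stable\<close>, \<open>admissible_extension\<close>).
\<close>

section \<open>Complex inner products\<close>

lemma cinner_add_right: "cinner x (y + z) = cinner x y + cinner x (z::'a::complex_inner)"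
  by (metis cinner_add_left cinner_commute complex_cnj_add)

lemma cinner_scaleC_right: "cinner x (a *\<^sub>C y) = cnj a * cinner x (y::'a::complex_inner)"
  by (metis cinner_commute cinner_scaleC_left complex_cnj_mult)

lemma cinner_self: "cinner x x = of_real ((norm (x::'a::complex_inner))\<^sup>2)"
proof -
  have "Im (cinner x x) = 0"
    by (metis cinner_commute complex_cnj_cancel_iff cnj.simps(2) neg_equal_zero)
  then show ?thesis
    by (simp add: complex_eq_iff norm_eq_sqrt_cinner cinner_ge_zero)
qed

lemma mult_cnj_cmod: "z * cnj z = (of_real (cmod z))\<^sup>2" "cnj z * z = (of_real (cmod z))\<^sup>2"
  by (simp_all add: complex_norm_square[symmetric] mult.commute flip: of_real_power)

lemma norm_scaleC: "norm (c *\<^sub>C x) = cmod c * norm (x::'a::complex_inner)"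
proof -
  have "complex_of_real ((norm (c *\<^sub>C x))\<^sup>2) = of_real ((cmod c * norm x)\<^sup>2)"
    unfolding cinner_self[symmetric] cinner_scaleC_left cinner_scaleC_right
    by (simp add: cinner_self power_mult_distrib mult_cnj_cmod flip: mult.assoc)
  then show ?thesis
    by (metis mult_nonneg_nonneg norm_ge_zero of_real_eq_iff power2_eq_imp_eq)
qed

lemma cinner_diff_scaleC_self:
  fixes x y :: "'a::complex_inner"
  shows "cinner (x - c *\<^sub>C y) (x - c *\<^sub>C y) =
    cinner x x - cnj c * cinner x y - c * cinner y x + c * cnj c * cinner y y"
proof -
  have "x - c *\<^sub>C y = x + (- c) *\<^sub>C y"
    by simp
  then show ?thesis
    by (simp only: cinner_add_left cinner_add_right cinner_scaleC_left cinner_scaleC_right)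
      (simp add: algebra_simps)
qed

lemma Cauchy_Schwarz_cinner: "cmod (cinner x y) \<le> norm x * norm (y::'a::complex_inner)"
proof (cases "y = 0")
  case True
  have "cinner x 0 = 0"
    by (metis add_cancel_left_left cinner_add_right)
  with True show ?thesis by simp
next
  case False
  define c where "c = cinner x y / of_real ((norm y)\<^sup>2)"
  have "cnj c * cinner x y = of_real ((cmod (cinner x y))\<^sup>2 / (norm y)\<^sup>2)"
    unfolding c_def by (simp add: mult_cnj_cmod)
  moreover have "c * cinner y x = of_real ((cmod (cinner x y))\<^sup>2 / (norm y)\<^sup>2)"
    unfolding c_def by (subst cinner_commute[of y x]) (simp add: mult_cnj_cmod)
  moreover have "c * cnj c * cinner y y = of_real ((cmod (cinner x y))\<^sup>2 / (norm y)\<^sup>2)"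
    using False unfolding c_def by (simp add: cinner_self mult_cnj_cmod power2_eq_square)
  ultimately have "(of_real ((norm (x - c *\<^sub>C y))\<^sup>2) :: complex) =
      of_real ((norm x)\<^sup>2 - (cmod (cinner x y))\<^sup>2 / (norm y)\<^sup>2)"
    using cinner_diff_scaleC_self[of x c y] by (simp add: cinner_self)
  then have "(norm (x - c *\<^sub>C y))\<^sup>2 = (norm x)\<^sup>2 - (cmod (cinner x y))\<^sup>2 / (norm y)\<^sup>2"
    using of_real_eq_iff by blast
  then have "(cmod (cinner x y))\<^sup>2 / (norm y)\<^sup>2 \<le> (norm x)\<^sup>2"
    by (metis diff_ge_0_iff_ge zero_le_power2)
  then have "(cmod (cinner x y))\<^sup>2 \<le> (norm x * norm y)\<^sup>2"
    using False by (simp add: field_simps power_mult_distrib)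
  then show ?thesis
    by (meson mult_nonneg_nonneg norm_ge_zero power2_le_imp_le)
qed

interpretation cinner: bounded_bilinear "cinner :: 'a::complex_inner \<Rightarrow> 'a \<Rightarrow> complex"
proof
  show "\<exists>K. \<forall>a b::'a. norm (cinner a b) \<le> norm a * norm b * K"
    by (rule exI[of _ 1]) (simp add: Cauchy_Schwarz_cinner)
qed (simp_all add: cinner_add_left cinner_add_right scaleR_scaleC[where 'a='a] cinner_scaleC_left
    cinner_scaleC_right scaleR_conv_of_real)

lemma norm_sum_orthonormal:
  assumes "orthonormal_seq e"
  shows "(norm (\<Sum>n<N. a n *\<^sub>C e n))\<^sup>2 = (\<Sum>n<N. (cmod (a n))\<^sup>2)"
proof -
  have "cinner (\<Sum>n<N. a n *\<^sub>C e n) (\<Sum>n<N. a n *\<^sub>C e n) = (\<Sum>n<N. a n * cnj (a n))"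
    using assms unfolding orthonormal_seq_def
    by (simp add: cinner.sum_left cinner.sum_right cinner_scaleC_left cinner_scaleC_right
        mult.commute if_distrib[of "\<lambda>x. _ * x"] sum.delta cong: if_cong)
  then have "complex_of_real ((norm (\<Sum>n<N. a n *\<^sub>C e n))\<^sup>2) =
      of_real (\<Sum>n<N. (cmod (a n))\<^sup>2)"
    by (simp add: cinner_self mult_cnj_cmod)
  then show ?thesis
    using of_real_eq_iff by blast
qed

section \<open>Orthonormal sequences and bounded functionals\<close>

definition bounded_cfunctional :: "('a::complex_hilbert \<Rightarrow> complex) \<Rightarrow> bool"
  where "bounded_cfunctional \<phi> \<longleftrightarrow>
    bounded_linear \<phi> \<and> (\<forall>c x. \<phi> (c *\<^sub>C x) = c * \<phi> x)"

text \<open>Bessel's inequality for a functional: testing \<open>\<phi>\<close> on the vector with coefficients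
  \<open>cnj (\<phi> (e n))\<close> bounds the sum of the \<open>(cmod (\<phi> (e n)))\<^sup>2\<close> by the square of a bound for \<open>\<phi>\<close>.
  Stating this for functionals also covers \<open>\<lambda>x. cinner (T x) f\<close> without an adjoint of \<open>T\<close>.\<close>

lemma orthonormal_weakly_null:
  assumes e: "orthonormal_seq e" and \<phi>: "bounded_cfunctional \<phi>"
  shows "(\<lambda>n. \<phi> (e n)) \<longlonglongrightarrow> 0"
proof -
  interpret \<phi>: bounded_linear \<phi>
    using \<phi> by (simp add: bounded_cfunctional_def)
  obtain B where B: "\<And>x. cmod (\<phi> x) \<le> norm x * B" "B > 0"
    using \<phi>.pos_bounded by blast
  have partial: "(\<Sum>n<N. (cmod (\<phi> (e n)))\<^sup>2) \<le> B\<^sup>2" for N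
  proof -
    define S where "S = (\<Sum>n<N. (cmod (\<phi> (e n)))\<^sup>2)"
    define x where "x = (\<Sum>n<N. cnj (\<phi> (e n)) *\<^sub>C e n)"
    have "\<phi> x = (\<Sum>n<N. \<phi> (e n) * cnj (\<phi> (e n)))"
      using \<phi> by (simp add: x_def \<phi>.sum bounded_cfunctional_def mult.commute)
    then have "cmod (\<phi> x) = S"
      by (simp add: S_def mult_cnj_cmod sum_nonneg flip: of_real_power of_real_sum)
    moreover have S: "(norm x)\<^sup>2 = S"
      using norm_sum_orthonormal[OF e] by (simp add: x_def S_def)
    ultimately have "norm x * norm x \<le> norm x * B"
      using B(1)[of x] by (simp add: power2_eq_square flip: S)
    then have "norm x \<le> B"
      using B(2) by (cases "norm x = 0") auto
    then show ?thesis
      using power_mono[of "norm x" B 2] S by (simp add: S_def)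
  qed
  have "summable (\<lambda>n. (cmod (\<phi> (e n)))\<^sup>2)"
    using partial by (intro summableI_nonneg_bounded) auto
  then have "(\<lambda>n. sqrt ((cmod (\<phi> (e n)))\<^sup>2)) \<longlonglongrightarrow> sqrt 0"
    by (intro tendsto_real_sqrt summable_LIMSEQ_zero)
  then show ?thesis
    by (simp add: tendsto_norm_zero_iff)
qed

text \<open>The functionals are treated one at a time.  A functional \<open>\<phi>\<close> that vanishes on the common kernel of
  the earlier ones costs nothing; otherwise some \<open>z\<close> in that kernel has \<open>\<phi> z \<noteq> 0\<close>, and subtracting
  a suitable multiple of \<open>z\<close>, whose coefficient tends to \<open>0\<close>, repairs \<open>\<phi>\<close> and keeps the earlier
  equations.\<close>

lemma null_correction_into_kernels:
  fixes e :: "nat \<Rightarrow> 'a::complex_hilbert"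
  assumes e: "orthonormal_seq e" and "finite \<Phi>" and "\<And>\<phi>. \<phi> \<in> \<Phi> \<Longrightarrow> bounded_cfunctional \<phi>"
  shows "\<exists>s. s \<longlonglongrightarrow> 0 \<and> (\<forall>n. \<forall>\<phi>\<in>\<Phi>. \<phi> (e n - s n) = 0)"
  using assms(2,3)
proof (induction \<Phi> rule: finite_induct)
  case empty
  show ?case
    by (rule exI[of _ "\<lambda>_. 0"]) simp
next
  case (insert \<phi> \<Phi>)
  then obtain s where s: "s \<longlonglongrightarrow> 0" "\<And>n \<psi>. \<psi> \<in> \<Phi> \<Longrightarrow> \<psi> (e n - s n) = 0"
    by blast
  show ?case
  proof (cases "\<forall>z. (\<forall>\<psi>\<in>\<Phi>. \<psi> z = 0) \<longrightarrow> \<phi> z = 0")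
    case True
    with s show ?thesis
      by (intro exI[of _ s]) auto
  next
    case False
    then obtain z where z: "\<And>\<psi>. \<psi> \<in> \<Phi> \<Longrightarrow> \<psi> z = 0" "\<phi> z \<noteq> 0"
      by blast
    define t where "t n = s n + (\<phi> (e n - s n) / \<phi> z) *\<^sub>C z" for n
    interpret \<phi>: bounded_linear \<phi>
      using insert.prems by (simp add: bounded_cfunctional_def)
    have lin: "\<psi> (x - (y + c *\<^sub>C z)) = \<psi> (x - y) - c * \<psi> z"
      if "\<psi> \<in> insert \<phi> \<Phi>" for \<psi> x y c
    proof -
      interpret bounded_linear \<psi>
        using insert.prems that by (simp add: bounded_cfunctional_def)
      show ?thesis
        using insert.prems[OF that] by (simp add: diff add bounded_cfunctional_def)
    qed
    have "(\<lambda>n. \<phi> (e n) - \<phi> (s n)) \<longlonglongrightarrow> 0 - 0"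
      using insert.prems
      by (intro tendsto_diff orthonormal_weakly_null[OF e] \<phi>.tendsto_zero s(1)) auto
    then have "(\<lambda>n. \<phi> (e n - s n) / \<phi> z) \<longlonglongrightarrow> 0"
      by (simp add: \<phi>.diff tendsto_divide_zero)
    then have "(\<lambda>n. (\<phi> (e n - s n) / \<phi> z) *\<^sub>C z) \<longlonglongrightarrow> 0"
      by (subst tendsto_norm_zero_iff[symmetric])
        (auto simp: norm_scaleC intro!: tendsto_mult_left_zero tendsto_norm_zero)
    then have "t \<longlonglongrightarrow> 0"
      using tendsto_add[OF s(1)] by (simp add: t_def[abs_def])
    moreover have "\<forall>n. \<forall>\<psi>\<in>insert \<phi> \<Phi>. \<psi> (e n - t n) = 0"
      using s(2) z by (fastforce simp: t_def lin)
    ultimately show ?thesis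
      by blast
  qed
qed

section \<open>Exact values off a finite set\<close>

text \<open>Both \<open>v\<close> and \<open>T v\<close> avoid \<open>F\<close>, so that putting \<open>f\<close> and \<open>T f\<close> into \<open>F\<close> removes all cross terms
  between \<open>v\<close> and \<open>f\<close> from the quadratic form of \<open>T\<close>.\<close>

definition attained_off :: "('a::complex_hilbert \<Rightarrow> 'a) \<Rightarrow> 'a set \<Rightarrow> complex \<Rightarrow> bool"
  where "attained_off T F z \<longleftrightarrow>
    (\<exists>v. norm v = 1 \<and> (\<forall>f\<in>F. cinner v f = 0 \<and> cinner (T v) f = 0) \<and> cinner (T v) v = z)"

lemma bounded_clinearD:
  assumes "bounded_clinear T"
  shows "bounded_linear T" "T (c *\<^sub>C x) = c *\<^sub>C T x" "T (x + y) = T x + T y" "T (x - y) = T x - T y"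
  using assms linear_simps(1,2)[of T] by (auto simp: bounded_clinear_def)

lemma bounded_cfunctional_cinner: "bounded_cfunctional (\<lambda>x. cinner x f)"
  by (simp add: bounded_cfunctional_def cinner.bounded_linear_left cinner_scaleC_left)

lemma bounded_cfunctional_cinner_image:
  "bounded_clinear T \<Longrightarrow> bounded_cfunctional (\<lambda>x. cinner (T x) f)"
  using bounded_linear_compose[OF cinner.bounded_linear_left, of T f]
  by (simp add: bounded_cfunctional_def bounded_clinear_def cinner_scaleC_left)

text \<open>The normalised corrections \<open>e n - s n\<close> of a defining orthonormal sequence do this: as \<open>s n\<close>
  tends to \<open>0\<close>, neither the norms nor the values of the quadratic form change in the limit.\<close>

lemma ess_num_range_approximable:
  assumes T: "bounded_clinear T" and p: "p \<in> ess_num_range T" and F: "finite F" and "\<delta> > 0"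
  shows "\<exists>z. cmod (z - p) < \<delta> \<and> attained_off T F z"
proof -
  obtain e where e: "orthonormal_seq e" and lim: "(\<lambda>n. cinner (T (e n)) (e n)) \<longlonglongrightarrow> p"
    using p by (auto simp: ess_num_range_def)
  let ?\<Phi> = "(\<lambda>f x. cinner x f) ` F \<union> (\<lambda>f x. cinner (T x) f) ` F"
  obtain s where s: "s \<longlonglongrightarrow> 0" and kernel: "\<And>n. \<forall>\<phi>\<in>?\<Phi>. \<phi> (e n - s n) = 0"
    using null_correction_into_kernels[OF e, of ?\<Phi>] F
      bounded_cfunctional_cinner bounded_cfunctional_cinner_image[OF T] by blast
  obtain M where M: "\<And>x. norm (T x) \<le> norm x * M" "M > 0"
    using bounded_linear.pos_bounded[OF bounded_clinearD(1)[OF T]] by blast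
  have e1: "norm (e n) = 1" for n
    using e cinner_self[of "e n"] by (simp add: orthonormal_seq_def norm_eq_sqrt_cinner)
  define w where "w n = e n - s n" for n
  have CS: "cmod (cinner (T x) y) \<le> norm x * M * norm y" for x y
    using Cauchy_Schwarz_cinner[of "T x" y] mult_right_mono[OF M(1)[of x], of "norm y"] by simp
  have ns: "(\<lambda>n. norm (s n)) \<longlonglongrightarrow> 0"
    using s by (rule tendsto_norm_zero)
  have "(\<lambda>n. norm (w n) - norm (e n)) \<longlonglongrightarrow> 0"
    by (rule Lim_null_comparison[OF _ ns]) (simp add: w_def norm_triangle_ineq3 always_eventually
        order.trans[OF norm_triangle_ineq3])
  then have norm_w: "(\<lambda>n. norm (w n)) \<longlonglongrightarrow> 1"
    by (simp add: e1 LIM_zero_iff)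
  have "(\<lambda>n. cinner (T (w n)) (w n) - cinner (T (e n)) (e n)) \<longlonglongrightarrow> 0"
  proof (rule Lim_null_comparison)
    show "\<forall>\<^sub>F n in sequentially. cmod (cinner (T (w n)) (w n) - cinner (T (e n)) (e n)) \<le>
        M * norm (s n) + norm (s n) * M * norm (w n)"
    proof (intro always_eventually allI)
      fix n
      have "cinner (T (w n)) (w n) - cinner (T (e n)) (e n) =
          - (cinner (T (e n)) (s n) + cinner (T (s n)) (w n))"
        by (simp add: w_def bounded_clinearD[OF T] cinner.diff_left cinner.diff_right)
      then show "cmod (cinner (T (w n)) (w n) - cinner (T (e n)) (e n)) \<le>
          M * norm (s n) + norm (s n) * M * norm (w n)"
        using CS[of "e n" "s n"] CS[of "s n" "w n"]
        by (simp only: norm_minus_cancel e1) (auto intro: order.trans[OF norm_triangle_ineq])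
    qed
    show "(\<lambda>n. M * norm (s n) + norm (s n) * M * norm (w n)) \<longlonglongrightarrow> 0"
      using tendsto_add[OF tendsto_mult_right_zero[OF ns] tendsto_mult[OF tendsto_mult_left_zero[OF ns] norm_w]]
      by simp
  qed
  from tendsto_add[OF this lim] have "(\<lambda>n. cinner (T (w n)) (w n)) \<longlonglongrightarrow> p"
    by simp
  then have "(\<lambda>n. cinner (T (w n)) (w n) / of_real ((norm (w n))\<^sup>2)) \<longlonglongrightarrow> p / of_real (1\<^sup>2)"
    by (intro tendsto_intros norm_w) auto
  then have "(\<lambda>n. cinner (T (w n)) (w n) / of_real ((norm (w n))\<^sup>2)) \<longlonglongrightarrow> p"
    by simp
  from tendstoD[OF this \<open>\<delta> > 0\<close>] order_tendstoD(1)[OF norm_w zero_less_one]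
  have "\<forall>\<^sub>F n in sequentially. 
      dist (cinner (T (w n)) (w n) / of_real ((norm (w n))\<^sup>2)) p < \<delta> \<and> 0 < norm (w n)"
    by (rule eventually_conj)
  then obtain n where n: "cmod (cinner (T (w n)) (w n) / of_real ((norm (w n))\<^sup>2) - p) < \<delta>"
      "norm (w n) > 0"
    by (auto simp: eventually_sequentially dist_norm)
  define v where "v = of_real (1 / norm (w n)) *\<^sub>C w n"
  have "norm v = 1"
    using n(2) by (simp add: v_def norm_scaleC norm_divide)
  moreover have "cinner v f = 0 \<and> cinner (T v) f = 0" if "f \<in> F" for f
  proof -
    have "cinner (w n) f = 0" "cinner (T (w n)) f = 0"
      using that kernel[of n] by (auto simp: w_def)
    then show ?thesis
      by (simp add: v_def bounded_clinearD(2)[OF T] cinner_scaleC_left)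
  qed
  moreover have "cinner (T v) v = cinner (T (w n)) (w n) / of_real ((norm (w n))\<^sup>2)"
    by (simp add: v_def bounded_clinearD[OF T] cinner_scaleC_left cinner_scaleC_right power2_eq_square)
  ultimately show ?thesis
    using n(1) unfolding attained_off_def by blast
qed

lemma unit_combination:
  assumes T: "bounded_clinear T" and "norm v = 1" "norm x = 1"
    and orth: "cinner x v = 0" "cinner (T x) v = 0" "cinner x (T v) = 0"
    and t: "0 \<le> t" "t \<le> 1"
  defines "u \<equiv> of_real (sqrt (1 - t)) *\<^sub>C v + of_real (sqrt t) *\<^sub>C x"
  shows "norm u = 1" "cinner (T u) u = of_real (1 - t) * cinner (T v) v + of_real t * cinner (T x) x"
proof -
  have orth': "cinner v x = 0" "cinner (T v) x = 0"
    using orth cinner_commute[of v x] cinner_commute[of "T v" x] by simp_all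
  have sq: "complex_of_real (sqrt t) * of_real (sqrt t) = of_real t"
    "complex_of_real (sqrt (1 - t)) * of_real (sqrt (1 - t)) = of_real (1 - t)"
    using t by (simp_all flip: of_real_mult)
  have "cinner u u = of_real (1 - t) * cinner v v + of_real t * cinner x x"
    unfolding u_def
    by (simp add: cinner_add_left cinner_add_right cinner_scaleC_left cinner_scaleC_right orth orth'
        sq mult.assoc[symmetric] del: of_real_diff)
  then have "cinner u u = 1"
    using assms by (simp add: cinner_self)
  then show "norm u = 1"
    by (simp add: norm_eq_sqrt_cinner)
  show "cinner (T u) u = of_real (1 - t) * cinner (T v) v + of_real t * cinner (T x) x"
    unfolding u_def
    by (simp add: bounded_clinearD[OF T] cinner_add_left cinner_add_right cinner_scaleC_left
        cinner_scaleC_right orth orth' sq mult.assoc[symmetric] del: of_real_diff)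
qed

text \<open>Induction on \<open>P\<close>: the vector \<open>v\<close> for the new point is chosen first, and the vectors for the
  remaining points are chosen off \<open>F \<union> {v, T v}\<close>, so that \<open>unit_combination\<close> realises every point
  of the segments from the value of \<open>v\<close> to the old hull.  The values \<open>w p\<close> are perturbed because
  points of the essential numerical range need not be attained exactly.\<close>

lemma hull_of_perturbed_values_attained:
  assumes T: "bounded_clinear T" and "finite P" "P \<subseteq> ess_num_range T" "finite F" "\<delta> > 0"
  shows "\<exists>w. (\<forall>p\<in>P. cmod (w p - p) < \<delta>) \<and> (\<forall>z \<in> convex hull (w ` P). attained_off T F z)"
  using assms(2-4)
proof (induction P arbitrary: F rule: finite_induct)
  case empty
  then show ?case by simp
next
  case (insert p P)
  obtain v where v: "norm v = 1" "\<And>f. f \<in> F \<Longrightarrow> cinner v f = 0 \<and> cinner (T v) f = 0"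
      "cmod (cinner (T v) v - p) < \<delta>"
    using ess_num_range_approximable[OF T _ \<open>finite F\<close> \<open>\<delta> > 0\<close>, of p] insert.prems
    unfolding attained_off_def by blast
  obtain w where w: "\<And>q. q \<in> P \<Longrightarrow> cmod (w q - q) < \<delta>"
      "\<And>z. z \<in> convex hull (w ` P) \<Longrightarrow> attained_off T (F \<union> {v, T v}) z"
    using insert.IH[of "F \<union> {v, T v}"] insert.prems by auto
  let ?w = "w(p := cinner (T v) v)"
  have img: "?w ` insert p P = insert (cinner (T v) v) (w ` P)"
    using insert.hyps by auto
  have "attained_off T F z" if z: "z \<in> convex hull (?w ` insert p P)" for z
  proof (cases "P = {}")
    case True
    with z v show ?thesis
      by (auto simp: attained_off_def)
  next
    case False
    then have "w ` P \<noteq> {}" by simp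
    from z[unfolded img convex_hull_insert[OF this]] obtain a t b where
      t: "a \<ge> 0" "t \<ge> 0" "a + t = 1" and b: "b \<in> convex hull (w ` P)"
      and "z = a *\<^sub>R cinner (T v) v + t *\<^sub>R b"
      by auto
    moreover have "a = 1 - t"
      using t by simp
    ultimately have z_eq: "z = of_real (1 - t) * cinner (T v) v + of_real t * b"
      by (simp only: scaleR_conv_of_real)
    from w(2)[OF b] obtain x where x: "norm x = 1"
      "\<And>f. f \<in> F \<union> {v, T v} \<Longrightarrow> cinner x f = 0 \<and> cinner (T x) f = 0" "cinner (T x) x = b"
      unfolding attained_off_def by blast
    define u where "u = of_real (sqrt (1 - t)) *\<^sub>C v + of_real (sqrt t) *\<^sub>C x"
    have "norm u = 1" "cinner (T u) u = z"
      using unit_combination[OF T v(1) x(1), of t] x(2)[of v] x(2)[of "T v"] t x(3)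
      by (auto simp: u_def z_eq)
    moreover have "cinner u f = 0 \<and> cinner (T u) f = 0" if "f \<in> F" for f
      using that v(2)[of f] x(2)[of f]
      by (simp add: u_def bounded_clinearD[OF T] cinner_add_left cinner_scaleC_left)
    ultimately show ?thesis
      unfolding attained_off_def by blast
  qed
  moreover have "cmod (?w q - q) < \<delta>" if "q \<in> insert p P" for q
    using that v(3) w(1) by auto
  ultimately show ?case
    by blast
qed

text \<open>If \<open>l\<close> were outside, a line through \<open>l\<close> with normal \<open>a\<close> would have all perturbed corners strictly
  on one side.  But some corner lies at distance at least \<open>\<epsilon> / 2\<close> from that line on its other side,
  since \<open>cmod a \<le> \<bar>Re a\<bar> + \<bar>Im a\<bar>\<close>, and a perturbation below \<open>\<epsilon> / 2\<close> cannot move it across.\<close>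

lemma perturbed_square_hull:
  fixes l :: complex
  assumes "\<epsilon> > 0"
    and w: "\<And>p. p \<in> {l + \<epsilon>, l - \<epsilon>, l + \<i> * \<epsilon>, l - \<i> * \<epsilon>} \<Longrightarrow> cmod (w p - p) < \<epsilon> / 2"
  shows "l \<in> convex hull (w ` {l + \<epsilon>, l - \<epsilon>, l + \<i> * \<epsilon>, l - \<i> * \<epsilon>})"
proof (rule ccontr)
  let ?P = "{l + \<epsilon>, l - \<epsilon>, l + \<i> * \<epsilon>, l - \<i> * \<epsilon>}"
  assume "\<not> ?thesis"
  moreover have "closed (convex hull (w ` ?P))"
    by (intro compact_imp_closed compact_convex_hull finite_imp_compact) auto
  ultimately obtain a b where "inner a l < b" "\<And>x. x \<in> convex hull (w ` ?P) \<Longrightarrow> inner a x > b"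
    using separating_hyperplane_closed_point[of "convex hull (w ` ?P)" l] by auto
  then have pos: "inner a (w p - l) > 0" if "p \<in> ?P" for p
    using that hull_subset[of "w ` ?P" convex] by (fastforce simp: inner_diff_right)
  have pos': "inner a (p - l) + cmod a * (\<epsilon> / 2) > 0" if "p \<in> ?P" for p
  proof -
    have "inner a (w p - p) \<le> cmod a * cmod (w p - p)"
      by (rule norm_cauchy_schwarz)
    also have "\<dots> \<le> cmod a * (\<epsilon> / 2)"
      using w[OF that] by (intro mult_left_mono) auto
    finally show ?thesis
      using pos[OF that] by (simp add: inner_diff_right)
  qed
  have "\<bar>Re a\<bar> * \<epsilon> < cmod a * (\<epsilon> / 2)" "\<bar>Im a\<bar> * \<epsilon> < cmod a * (\<epsilon> / 2)"
    using pos'[of "l + \<epsilon>"] pos'[of "l - \<epsilon>"] pos'[of "l + \<i> * \<epsilon>"] pos'[of "l - \<i> * \<epsilon>"]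
    by (auto simp: inner_complex_def abs_if)
  then have "\<epsilon> * (\<bar>Re a\<bar> + \<bar>Im a\<bar>) < \<epsilon> * cmod a"
    by (simp add: algebra_simps)
  then show False
    using \<open>\<epsilon> > 0\<close> cmod_le[of a] by (simp add: not_less)
qed

lemma interior_ess_num_range_attained:
  assumes T: "bounded_clinear T" and l: "l \<in> interior (ess_num_range T)" and F: "finite F"
  shows "attained_off T F l"
proof -
  obtain \<epsilon> where \<epsilon>: "\<epsilon> > 0" "cball l \<epsilon> \<subseteq> ess_num_range T"
    using l mem_interior_cball by blast
  let ?P = "{l + \<epsilon>, l - \<epsilon>, l + \<i> * \<epsilon>, l - \<i> * \<epsilon>}"
  have "?P \<subseteq> cball l \<epsilon>"
    using \<epsilon>(1) by (auto simp: dist_norm norm_mult)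
  then have "?P \<subseteq> ess_num_range T"
    using \<epsilon>(2) by blast
  then obtain w where w: "\<forall>p\<in>?P. cmod (w p - p) < \<epsilon> / 2"
    "\<forall>z \<in> convex hull (w ` ?P). attained_off T F z"
    using hull_of_perturbed_values_attained[OF T _ _ F, of ?P "\<epsilon> / 2"] \<epsilon>(1) by force
  have "l \<in> convex hull (w ` ?P)"
    using w(1) by (intro perturbed_square_hull[OF \<epsilon>(1)]) blast
  with w(2) show ?thesis
    by blast
qed

section \<open>Distance to the frontier and capturing a residual\<close>

text \<open>A ball that meets \<open>S\<close> but not its frontier lies in \<open>S\<close>, because it is connected.\<close>

lemma ball_infdist_frontier_subset_interior:
  fixes S :: "'a::real_normed_vector set"
  assumes "x \<in> interior S"
  shows "ball x (infdist x (frontier S)) \<subseteq> interior S"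
proof (cases "infdist x (frontier S) > 0")
  case True
  let ?B = "ball x (infdist x (frontier S))"
  have disj: "?B \<inter> frontier S = {}"
    by (metis disjoint_iff infdist_le linorder_not_le mem_ball)
  have "x \<in> ?B \<inter> S"
    using True subsetD[OF interior_subset assms] by simp
  then have "?B \<inter> S \<noteq> {}"
    by blast
  with disj have "?B - S = {}"
    using connected_Int_frontier[OF connected_ball] by blast
  then have "?B \<subseteq> S"
    by blast
  then show ?thesis
    by (intro interior_maximal open_ball)
next
  case False
  then have "ball x (infdist x (frontier S)) = {}"
    by (intro ball_empty) simp
  then show ?thesis
    by (simp only: empty_subsetI)
qed

lemma ess_num_range_norm_le:
  assumes M: "\<And>x. norm (T x) \<le> M * norm x" and p: "p \<in> ess_num_range T"
  shows "cmod p \<le> M"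
proof -
  obtain e where e: "orthonormal_seq e" and lim: "(\<lambda>n. cinner (T (e n)) (e n)) \<longlonglongrightarrow> p"
    using p by (auto simp: ess_num_range_def)
  have "cmod (cinner (T (e n)) (e n)) \<le> M" for n
  proof -
    have "norm (e n) = 1"
      using e by (simp add: orthonormal_seq_def norm_eq_sqrt_cinner)
    then show ?thesis
      using Cauchy_Schwarz_cinner[of "T (e n)" "e n"] M[of "e n"] by simp
  qed
  then show ?thesis
    by (intro LIMSEQ_le_const2[OF tendsto_norm[OF lim]]) auto
qed

text \<open>A larger distance would put a ball of radius above \<open>2 * M\<close> around \<open>l\<close> into a set contained
  in the disc of radius \<open>M\<close>.\<close>

lemma infdist_frontier_ess_num_range_le:
  assumes M: "\<And>x. norm (T x) \<le> M * norm x" and l: "l \<in> interior (ess_num_range T)"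
  shows "infdist l (frontier (ess_num_range T)) \<le> 2 * M"
proof (rule ccontr)
  define d where "d = infdist l (frontier (ess_num_range T))"
  assume "\<not> ?thesis"
  then have d: "d > 2 * M"
    by (simp add: d_def)
  define s where "s = (2 * M + d) / 2"
  have s_eq: "2 * s = 2 * M + d"
    by (simp add: s_def)
  have "l \<in> ess_num_range T"
    using l interior_subset by blast
  then have lM: "cmod l \<le> M"
    by (rule ess_num_range_norm_le[OF M])
  then have "M \<ge> 0"
    using norm_ge_zero[of l] by linarith
  have "dist l (l + of_real s) = \<bar>s\<bar>"
    by (simp add: dist_norm)
  then have "l + of_real s \<in> ball l d"
    using d \<open>M \<ge> 0\<close> by (simp add: s_def)
  then have "l + of_real s \<in> ess_num_range T"
    using ball_infdist_frontier_subset_interior[OF l] interior_subset unfolding d_def by blast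
  then have "cmod (l + of_real s) \<le> M"
    by (rule ess_num_range_norm_le[OF M])
  moreover have "\<bar>s\<bar> \<le> cmod (l + of_real s) + cmod l"
    using norm_triangle_ineq4[of "l + of_real s" l]
    by (simp only: add_diff_cancel_left' norm_of_real)
  ultimately show False
    using lM d abs_ge_self[of s] s_eq by linarith
qed

text \<open>The vector is \<open>u = sqrt \<gamma> *\<^sub>C r' + sqrt (1 - \<gamma>) *\<^sub>C x\<close>, where \<open>r'\<close> is the normalised \<open>r\<close> and
  \<open>x\<close> has no cross terms with \<open>r'\<close>.  Then \<open>\<gamma>\<close> of \<open>(norm r)\<^sup>2\<close> is captured, and \<open>x\<close> has to attain
  the value \<open>m\<close> with \<open>l = \<gamma> * \<tau> + (1 - \<gamma>) * m\<close>, where \<open>\<tau>\<close> is the value at \<open>r'\<close>.  Since \<open>l\<close> and \<open>\<tau>\<close>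
  have modulus at most \<open>M\<close>, the constant \<open>8\<close> keeps \<open>m\<close> within half the distance from \<open>l\<close> to the
  frontier.  As \<open>x\<close> and \<open>T x\<close> are orthogonal to \<open>F\<close>, the vectors \<open>u\<close> and \<open>T u\<close> inherit from \<open>r\<close>
  and \<open>T r\<close> their orthogonality to elements of \<open>F\<close>.\<close>

lemma unit_vector_capturing_residual:
  assumes T: "bounded_clinear T" and M: "\<And>x. norm (T x) \<le> M * norm x" "M > 0"
    and l: "l \<in> interior (ess_num_range T)" and F: "finite F"
  defines "\<gamma> \<equiv> infdist l (frontier (ess_num_range T)) / (8 * M)"
  shows "\<exists>u. norm u = 1 \<and> cinner (T u) u = l \<and> \<gamma> * (norm r)\<^sup>2 \<le> (cmod (cinner r u))\<^sup>2 \<and>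
    (\<forall>f\<in>F. (cinner r f = 0 \<longrightarrow> cinner u f = 0) \<and> (cinner (T r) f = 0 \<longrightarrow> cinner (T u) f = 0))"
proof (cases "r = 0")
  case True
  with interior_ess_num_range_attained[OF T l F] show ?thesis
    by (auto simp: attained_off_def)
next
  case False
  define d where "d = infdist l (frontier (ess_num_range T))"
  have "d \<ge> 0" "d \<le> 2 * M"
    using infdist_frontier_ess_num_range_le[OF M(1) l] by (auto simp: d_def infdist_nonneg)
  then have \<gamma>: "0 \<le> \<gamma>" "\<gamma> \<le> 1 / 4" and d_eq: "d = \<gamma> * 8 * M"
    using M(2) by (auto simp: \<gamma>_def d_def field_simps)
  define r' where "r' = of_real (1 / norm r) *\<^sub>C r"
  have r': "norm r' = 1"
    using False by (simp add: r'_def norm_scaleC norm_divide)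
  have rr': "r = of_real (norm r) *\<^sub>C r'"
    using False by (simp add: r'_def scaleC_scaleC scaleC_one flip: of_real_mult)
  define \<tau> where "\<tau> = cinner (T r') r'"
  have "cmod \<tau> \<le> M"
    using Cauchy_Schwarz_cinner[of "T r'" r'] M(1)[of r'] by (simp add: r' \<tau>_def)
  moreover have "cmod l \<le> M"
    using l interior_subset by (blast intro: ess_num_range_norm_le[OF M(1)])
  ultimately have diff: "cmod (l - \<tau>) \<le> 2 * M"
    using norm_triangle_ineq4[of l \<tau>] by simp
  define m where "m = (l - of_real \<gamma> * \<tau>) / of_real (1 - \<gamma>)"
  have nz: "complex_of_real (1 - \<gamma>) \<noteq> 0"
    using \<gamma> by (simp only: of_real_eq_0_iff)
  have "m - l = of_real (\<gamma> / (1 - \<gamma>)) * (l - \<tau>)"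
    using nz by (simp add: m_def field_simps)
  then have "cmod (m - l) = \<gamma> / (1 - \<gamma>) * cmod (l - \<tau>)"
    using \<gamma> by (simp only: norm_mult norm_of_real) simp
  \<comment> \<open>Since \<open>\<gamma> \<le> 1 / 4\<close>, the denominator \<open>1 - \<gamma>\<close> is at least \<open>1 / 2\<close>.\<close>
  also have "\<dots> \<le> 2 * \<gamma> * (2 * M)"
    using \<gamma> diff M(2) mult_left_mono[of \<gamma> "1/4" \<gamma>] 
    by (intro mult_mono) (auto simp: field_simps)
  finally have near: "cmod (m - l) \<le> d / 2"
    by (simp add: d_eq mult.commute)
  have "m \<in> interior (ess_num_range T)"
  \<comment> \<open>For \<open>d = 0\<close> the ball is empty, but then the value is not shifted at all.\<close>
  proof (cases "d = 0")
    case True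
    with near l show ?thesis by simp
  next
    case False
    with near \<open>d \<ge> 0\<close> have "m \<in> ball l d"
      by (simp add: dist_norm norm_minus_commute)
    then show ?thesis
      using ball_infdist_frontier_subset_interior[OF l] by (auto simp: d_def)
  qed
  from interior_ess_num_range_attained[OF T this, of "F \<union> {r', T r'}"] F
  obtain x where x: "norm x = 1"
    "\<And>f. f \<in> F \<union> {r', T r'} \<Longrightarrow> cinner x f = 0 \<and> cinner (T x) f = 0" "cinner (T x) x = m"
    unfolding attained_off_def by auto
  define u where "u = of_real (sqrt (1 - (1 - \<gamma>))) *\<^sub>C r' + of_real (sqrt (1 - \<gamma>)) *\<^sub>C x"
  have u: "norm u = 1" "cinner (T u) u = of_real \<gamma> * \<tau> + of_real (1 - \<gamma>) * m"
    using unit_combination[OF T r' x(1), of "1 - \<gamma>"] x(2)[of r'] x(2)[of "T r'"] \<gamma> x(3)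
    by (auto simp: u_def \<tau>_def)
  have "cinner (T u) u = l"
    using nz by (simp add: u m_def)
  moreover have "\<gamma> * (norm r)\<^sup>2 \<le> (cmod (cinner r u))\<^sup>2"
  proof -
    have "cinner r' x = 0"
      using x(2)[of r'] cinner_commute[of r' x] by simp
    then have "cinner r u = of_real (norm r * sqrt \<gamma>)"
      by (subst rr') (simp add: u_def cinner_add_right cinner_scaleC_left cinner_scaleC_right
          cinner_self r')
    then have "(cmod (cinner r u))\<^sup>2 = (norm r * sqrt \<gamma>)\<^sup>2"
      by (simp only: norm_of_real power2_abs)
    then show ?thesis
      using \<gamma> by (simp add: power_mult_distrib)
  qed
  moreover have "(cinner r f = 0 \<longrightarrow> cinner u f = 0) \<and> (cinner (T r) f = 0 \<longrightarrow> cinner (T u) f = 0)"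
    if "f \<in> F" for f
    using x(2)[of f] that
    by (simp add: u_def r'_def bounded_clinearD[OF T] cinner_add_left cinner_scaleC_left)
  ultimately show ?thesis
    using u(1) by blast
qed

section \<open>Splitting a divergent series\<close>

lemma divergent_residue_class:
  fixes g :: "nat \<Rightarrow> real"
  assumes "p > 0" and unbounded: "\<And>B. \<exists>N. B \<le> (\<Sum>n<N. g n)"
  shows "\<exists>i<p. \<forall>B. \<exists>N. B \<le> (\<Sum>n<N. if n mod p = i then g n else 0)"
proof (rule ccontr)
  assume "\<not> ?thesis"
  then have "\<forall>i. \<exists>B. i < p \<longrightarrow> (\<forall>N. (\<Sum>n<N. if n mod p = i then g n else 0) < B)"
    by (meson not_le)
  then obtain B where B: "\<And>i N. i < p \<Longrightarrow> (\<Sum>n<N. if n mod p = i then g n else 0) < B i"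
    by metis
  obtain N where N: "(\<Sum>i<p. B i) \<le> (\<Sum>n<N. g n)"
    using unbounded by blast
  have "(\<Sum>n<N. g n) = (\<Sum>n<N. \<Sum>i<p. if n mod p = i then g n else 0)"
    using \<open>p > 0\<close> by (simp add: sum.delta')
  also have "\<dots> = (\<Sum>i<p. \<Sum>n<N. if n mod p = i then g n else 0)"
    by (rule sum.swap)
  also have "\<dots> < (\<Sum>i<p. B i)"
    using B \<open>p > 0\<close> by (intro sum_strict_mono) auto
  finally show False
    using N by simp
qed

text \<open>The label of \<open>n\<close> depends only on the integer part of the partial sum \<open>S n\<close>.  Hence it cannot change
  after a zero term, and each integer part \<open>v\<close> collects a total of at least \<open>1 / 2\<close>, because the
  steps of \<open>S\<close> have size at most \<open>1 / 4\<close>.  Decoding \<open>v\<close> as a pair and keeping the first component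
  gives every label infinitely many values of \<open>v\<close>.\<close>

lemma divergent_split:
  fixes h :: "nat \<Rightarrow> real"
  assumes h: "\<And>n. 0 \<le> h n" "\<And>n. h n \<le> 1 / 4" and unbounded: "\<And>B. \<exists>N. B \<le> (\<Sum>n<N. h n)"
  shows "\<exists>s :: nat \<Rightarrow> nat. (\<forall>n. h n = 0 \<longrightarrow> s (Suc n) = s n) \<and>
    (\<forall>m B. \<exists>N. B \<le> (\<Sum>n<N. if s n = m then h n else 0))"
proof -
  define S where "S n = (\<Sum>k<n. h k)" for n
  define s where "s n = fst (prod_decode (nat \<lfloor>S n\<rfloor>))" for n
  have mono: "S m \<le> S n" if "m \<le> n" for m n
    unfolding S_def using that h(1) by (intro sum_mono2) auto
  have gain: "\<exists>N'. (\<Sum>n<N. if s n = m then h n else 0) + 1 / 2 \<le> (\<Sum>n<N'. if s n = m then h n else 0)"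
    for m N
  proof -
    \<comment> \<open>A value \<open>v\<close> with label \<open>m\<close> that the partial sums have not reached at \<open>N\<close>.\<close>
    define v where "v = prod_encode (m, nat \<lceil>S N\<rceil> + 1)"
    have "real (nat \<lceil>S N\<rceil> + 1) \<le> real v"
      unfolding v_def of_nat_le_iff by (rule le_prod_encode_2)
    then have v: "S N < real v" "v \<ge> 1"
      by linarith+
    define a where "a = (LEAST n. real v \<le> S n)"
    define b where "b = (LEAST n. real v + 1 \<le> S n)"
    have a: "real v \<le> S a"
      using unbounded[of "real v"] unfolding a_def S_def by (rule LeastI_ex)
    have below_a: "S n < real v" if "n < a" for n
      using not_less_Least[of n "\<lambda>n. real v \<le> S n"] that unfolding a_def by simp
    have b: "real v + 1 \<le> S b"
      using unbounded[of "real v + 1"] unfolding b_def S_def by (rule LeastI_ex)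
    have below_b: "S n < real v + 1" if "n < b" for n
      using not_less_Least[of n "\<lambda>n. real v + 1 \<le> S n"] that unfolding b_def by simp
    have Sa: "S a \<le> real v + 1 / 4"
    proof (cases a)
      case 0
      then show ?thesis by (simp add: S_def)
    next
      case (Suc n)
      then show ?thesis
        using below_a[of n] h(2)[of n] by (simp add: S_def)
    qed
    have "a \<le> b"
      using below_a[of b] b by (cases "a \<le> b") auto
    have "N \<le> a"
      using mono[of a N] a v(1) by (cases "N \<le> a") auto
    have level: "s n = m" if "n \<in> {a..<b}" for n
    proof -
      have "real v \<le> S n" "S n < real v + 1"
        using that a mono[of a n] below_b[of n] by auto
      then have "nat \<lfloor>S n\<rfloor> = v"
        by linarith
      then show ?thesis
        by (simp add: s_def v_def)
    qed
    let ?c = "\<lambda>n. if s n = m then h n else 0"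
    have "S b - S a = (\<Sum>n\<in>{a..<b}. h n)"
      using sum_diff_nat_ivl[of 0 a b h] \<open>a \<le> b\<close> by (simp add: S_def lessThan_atLeast0)
    also have "\<dots> = (\<Sum>n\<in>{a..<b}. ?c n)"
      by (intro sum.cong refl) (simp add: level)
    also have "\<dots> = (\<Sum>n<b. ?c n) - (\<Sum>n<a. ?c n)"
      using sum_diff_nat_ivl[of 0 a b ?c] \<open>a \<le> b\<close> by (simp add: lessThan_atLeast0)
    finally have "(\<Sum>n<b. ?c n) - (\<Sum>n<a. ?c n) = S b - S a" by simp
    moreover have "(\<Sum>n<N. ?c n) \<le> (\<Sum>n<a. ?c n)"
      using h(1) \<open>N \<le> a\<close> by (intro sum_mono2) auto
    ultimately show ?thesis
      using b Sa by (intro exI[of _ b]) linarith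
  qed
  have "\<exists>N. real k / 2 \<le> (\<Sum>n<N. if s n = m then h n else 0)" for m k
  proof (induction k)
    case 0
    show ?case by (rule exI[of _ 0]) simp
  next
    case (Suc k)
    then obtain N where "real k / 2 \<le> (\<Sum>n<N. if s n = m then h n else 0)" by blast
    moreover obtain N' where "(\<Sum>n<N. if s n = m then h n else 0) + 1 / 2
        \<le> (\<Sum>n<N'. if s n = m then h n else 0)"
      using gain by blast
    ultimately show ?case
      by (intro exI[of _ N']) (simp add: add_divide_distrib)
  qed
  moreover have "\<exists>k. B \<le> real k / 2" for B
    using real_arch_simple[of "2 * B"] by (auto simp: field_simps)
  ultimately have "\<forall>m B. \<exists>N. B \<le> (\<Sum>n<N. if s n = m then h n else 0)"
    by (meson order.trans)
  moreover have "s (Suc n) = s n" if "h n = 0" for n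
    using that by (simp add: s_def S_def)
  ultimately show ?thesis
    by blast
qed

text \<open>Here \<open>A\<close> is the set of capturing indices and \<open>s n\<close> the number of the target treated at time \<open>n\<close>.
  The label may change only right after an index in \<open>A\<close>, so that the indices between two consecutive
  elements of \<open>A\<close> share the target of the later one.\<close>

lemma spaced_divergent_schedule:
  fixes g :: "nat \<Rightarrow> real"
  assumes g: "\<And>n. 0 \<le> g n" "\<And>n. g n \<le> 1 / 4" and unbounded: "\<And>B. \<exists>N. B \<le> (\<Sum>n<N. g n)"
  shows "\<exists>A (s :: nat \<Rightarrow> nat). (\<forall>m\<in>A. \<forall>n\<in>A. m < n \<longrightarrow> m + K < n) \<and>
    (\<forall>n. n \<notin> A \<longrightarrow> s (Suc n) = s n) \<and>
    (\<forall>m B. \<exists>N. B \<le> (\<Sum>n<N. if n \<in> A \<and> s n = m then g n else 0))"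
proof -
  obtain i where i: "\<And>B. \<exists>N. B \<le> (\<Sum>n<N. if n mod (Suc K) = i then g n else 0)"
    using divergent_residue_class[OF _ unbounded, of "Suc K"] by blast
  define A where "A = {n. n mod (Suc K) = i}"
  define h where "h n = (if n \<in> A then g n else 0)" for n
  have "\<exists>N. B \<le> (\<Sum>n<N. h n)" for B
    using i[of B] by (simp add: h_def A_def)
  moreover have hb: "0 \<le> h n" "h n \<le> 1 / 4" for n
    using g by (auto simp: h_def)
  ultimately obtain s :: "nat \<Rightarrow> nat" where s: "\<And>n. h n = 0 \<Longrightarrow> s (Suc n) = s n"
      "\<And>m B. \<exists>N. B \<le> (\<Sum>n<N. if s n = m then h n else 0)"
    using divergent_split[of h] hb by metis
  have "m + K < n" if "m \<in> A" "n \<in> A" "m < n" for m n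
  proof -
    have "Suc K dvd n - m"
      using that by (intro mod_eq_dvd_iff_nat[THEN iffD1]) (auto simp: A_def)
    then have "Suc K \<le> n - m"
      using that by (intro dvd_imp_le) auto
    then show ?thesis
      by simp
  qed
  moreover have "s (Suc n) = s n" if "n \<notin> A" for n
    using s(1) that by (simp add: h_def)
  moreover have "(if s n = m then h n else 0) = (if n \<in> A \<and> s n = m then g n else 0)" for m n
    by (simp add: h_def)
  ultimately show ?thesis
    using s(2) by (intro exI[of _ A] exI[of _ s]) auto
qed

section \<open>Construction of the basis\<close>

definition residual :: "(nat \<Rightarrow> 'a::complex_hilbert) \<Rightarrow> nat \<Rightarrow> 'a \<Rightarrow> 'a"
  where "residual u n y = y - (\<Sum>j<n. cinner y (u j) *\<^sub>C u j)"

lemma residual_cong: "(\<And>j. j < n \<Longrightarrow> u j = v j) \<Longrightarrow> residual u n y = residual v n y"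
  by (simp add: residual_def)

lemma residual_Suc: "residual u (Suc n) y = residual u n y - cinner y (u n) *\<^sub>C u n"
  by (simp add: residual_def)

lemma cinner_residual_orthogonal:
  assumes "\<And>j. j < n \<Longrightarrow> cinner x (u j) = 0"
  shows "cinner (residual u n y) x = cinner y x"
proof -
  have "cinner (u j) x = 0" if "j < n" for j
    using assms[OF that] cinner_commute[of "u j" x] by simp
  then show ?thesis
    by (simp add: residual_def cinner.diff_left cinner.sum_left cinner_scaleC_left)
qed

lemma cinner_residual_zero:
  assumes "\<And>i j. i < n \<Longrightarrow> j < n \<Longrightarrow> cinner (u i) (u j) = (if i = j then 1 else 0)" and "i < n"
  shows "cinner (residual u n y) (u i) = 0"
proof -
  have "(\<Sum>j<n. cinner y (u j) * cinner (u j) (u i)) = (\<Sum>j<n. if j = i then cinner y (u i) else 0)"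
    using assms by (intro sum.cong) auto
  then show ?thesis
    using assms(2) by (simp add: residual_def cinner.diff_left cinner.sum_left cinner_scaleC_left)
qed

text \<open>Pythagoras: passing to the next residual removes its component along \<open>u n\<close>.\<close>

lemma norm_residual_Suc:
  assumes "norm (u n) = 1" and orth: "\<And>j. j < n \<Longrightarrow> cinner (u n) (u j) = 0"
  shows "(norm (residual u (Suc n) y))\<^sup>2 =
    (norm (residual u n y))\<^sup>2 - (cmod (cinner (residual u n y) (u n)))\<^sup>2"
proof -
  let ?r = "residual u n y"
  have c: "cinner y (u n) = cinner ?r (u n)"
    using cinner_residual_orthogonal[OF orth] by simp
  have "complex_of_real ((norm (residual u (Suc n) y))\<^sup>2) =
      of_real ((norm ?r)\<^sup>2 - (cmod (cinner ?r (u n)))\<^sup>2)"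
    unfolding cinner_self[symmetric] residual_Suc c cinner_diff_scaleC_self
    by (subst (2) cinner_commute) (simp add: cinner_self assms(1) mult_cnj_cmod)
  then show ?thesis
    using of_real_eq_iff by blast
qed

lemma diff_residual_in_cspan: "y - residual u n y \<in> cspan (range u)"
  unfolding residual_def diff_diff_eq2 add_diff_cancel_left'
  by (intro complex_vector.span_sum complex_vector.span_scale complex_vector.span_base rangeI)

text \<open>The conditions under which \<open>x\<close> may be chosen as \<open>u n\<close>.  They depend only on the values of \<open>u\<close>
  below \<open>n\<close>, as needed for choosing \<open>u\<close> recursively.  For \<open>n \<notin> A\<close> the orthogonality to the
  residual and to its image prepares the next capturing step.\<close>

definition admissible_step ::
  "('a::complex_hilbert \<Rightarrow> 'a) \<Rightarrow> (nat \<Rightarrow> complex) \<Rightarrow> nat \<Rightarrow> nat set \<Rightarrow> (nat \<Rightarrow> real) \<Rightarrow> (nat \<Rightarrow> 'a) \<Rightarrow>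
    (nat \<Rightarrow> 'a) \<Rightarrow> nat \<Rightarrow> 'a \<Rightarrow> bool"
  where "admissible_step T l K A \<gamma> target u n x \<longleftrightarrow>
    norm x = 1 \<and> cinner (T x) x = l n \<and> (\<forall>j<n. cinner x (u j) = 0) \<and>
    (\<forall>j<n. n \<le> j + K \<longrightarrow> cinner (T x) (u j) = 0 \<and> cinner x (T (u j)) = 0) \<and>
    (let r = residual u n (target n) in
      if n \<in> A then \<gamma> n * (norm r)\<^sup>2 \<le> (cmod (cinner r x))\<^sup>2
      else cinner x r = 0 \<and> cinner x (T r) = 0 \<and> cinner (T x) r = 0)"

lemma admissible_orthonormal:
  assumes "\<And>j. j < n \<Longrightarrow> admissible_step T l K A \<gamma> target u j (u j)" and "i < n" "j < n"
  shows "cinner (u i) (u j) = (if i = j then 1 else 0)"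
proof -
  have less: "cinner (u b) (u a) = 0" if "a < b" "b < n" for a b
    using assms(1)[OF that(2)] that(1) by (simp add: admissible_step_def)
  have "cinner (u i) (u i) = 1"
    using assms(1)[OF assms(2)] by (simp add: admissible_step_def cinner_self)
  then show ?thesis
    using less[of i j] less[of j i] assms(2,3) cinner_commute[of "u i" "u j"]
    by (cases i j rule: linorder_cases) auto
qed

text \<open>At an index outside \<open>A\<close> the target stays the same and the new vector is orthogonal to the residual,
  so the residual is carried over unchanged.\<close>

lemma admissible_residual_stable:
  assumes adm: "\<And>j. j < n \<Longrightarrow> admissible_step T l K A \<gamma> target u j (u j)"
    and target: "\<And>k. k \<notin> A \<Longrightarrow> target (Suc k) = target k"
    and "j \<le> n" and gap: "\<And>k. j \<le> k \<Longrightarrow> k < n \<Longrightarrow> k \<notin> A"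
  shows "residual u n (target n) = residual u j (target j)"
  using \<open>j \<le> n\<close> adm gap
proof (induction n rule: dec_induct)
  case base
  show ?case ..
next
  case (step k)
  let ?r = "residual u k (target k)"
  have "k \<notin> A" and adm_k: "admissible_step T l K A \<gamma> target u k (u k)"
    using step.prems step.hyps by auto
  then have "cinner (u k) ?r = 0"
    by (simp add: admissible_step_def Let_def)
  then have "cinner ?r (u k) = 0"
    using cinner_commute[of ?r "u k"] by simp
  moreover have "cinner ?r (u k) = cinner (target k) (u k)"
    using adm_k by (intro cinner_residual_orthogonal) (simp add: admissible_step_def)
  ultimately have "residual u (Suc k) (target (Suc k)) = ?r"
    using target[OF \<open>k \<notin> A\<close>] by (simp add: residual_Suc)
  also have "?r = residual u j (target j)"
    using step.prems by (intro step.IH) auto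
  finally show ?case .
qed

text \<open>Outside \<open>A\<close> an attaining vector with all orthogonality relations exists.  For \<open>n \<in> A\<close> the vector
  has a component along the residual, which is orthogonal to all earlier \<open>u j\<close> anyway.  The last \<open>K\<close>
  indices lie outside \<open>A\<close>, and they were chosen with the same residual, so the orthogonality
  relations imposed on them are those needed for the band entries of \<open>u n\<close>.\<close>

lemma admissible_extension:
  assumes T: "bounded_clinear T" and M: "\<And>x. norm (T x) \<le> M * norm x" "M > 0"
    and l: "l n \<in> interior (ess_num_range T)"
    and \<gamma>: "\<gamma> n = infdist (l n) (frontier (ess_num_range T)) / (8 * M)"
    and spaced: "\<And>i j. i \<in> A \<Longrightarrow> j \<in> A \<Longrightarrow> i < j \<Longrightarrow> i + K < j"
    and target: "\<And>k. k \<notin> A \<Longrightarrow> target (Suc k) = target k"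
    and adm: "\<And>j. j < n \<Longrightarrow> admissible_step T l K A \<gamma> target u j (u j)"
  shows "\<exists>x. admissible_step T l K A \<gamma> target u n x"
proof -
  let ?r = "residual u n (target n)"
  let ?F = "u ` {..<n} \<union> (\<lambda>j. T (u j)) ` {..<n}"
  show ?thesis
  proof (cases "n \<in> A")
    case False
    have "attained_off T (?F \<union> {?r, T ?r}) (l n)"
      by (intro interior_ess_num_range_attained[OF T l]) auto
    then obtain x where "norm x = 1" "cinner (T x) x = l n"
      "\<And>f. f \<in> ?F \<union> {?r, T ?r} \<Longrightarrow> cinner x f = 0 \<and> cinner (T x) f = 0"
      unfolding attained_off_def by blast
    with False have "admissible_step T l K A \<gamma> target u n x"
      by (auto simp: admissible_step_def Let_def)
    then show ?thesis ..
  next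
    case True
    obtain x where x: "norm x = 1" "cinner (T x) x = l n" "\<gamma> n * (norm ?r)\<^sup>2 \<le> (cmod (cinner ?r x))\<^sup>2"
      and orth: "\<And>f. f \<in> ?F \<Longrightarrow> cinner ?r f = 0 \<Longrightarrow> cinner x f = 0"
        "\<And>f. f \<in> ?F \<Longrightarrow> cinner (T ?r) f = 0 \<Longrightarrow> cinner (T x) f = 0"
      using unit_vector_capturing_residual[OF T M l, of ?F ?r] unfolding \<gamma>[symmetric] by auto
    have on: "cinner (u i) (u j) = (if i = j then 1 else 0)" if "i < n" "j < n" for i j
      using adm that by (rule admissible_orthonormal)
    have "cinner x (u j) = 0" if "j < n" for j
    proof (rule orth(1))
      show "cinner ?r (u j) = 0"
        using on that by (rule cinner_residual_zero)
    qed (use that in simp)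
    moreover have "cinner (T x) (u j) = 0 \<and> cinner x (T (u j)) = 0" if j: "j < n" "n \<le> j + K" for j
    proof -
      have gap: "k \<notin> A" if "j \<le> k" "k < n" for k
        using spaced[of k n] True that j by auto
      have "?r = residual u j (target j)"
        using adm target less_imp_le[OF j(1)] gap by (rule admissible_residual_stable)
      moreover have "j \<notin> A"
        using gap j by simp
      ultimately have "cinner (u j) (T ?r) = 0" "cinner (T (u j)) ?r = 0"
        using adm[OF j(1)] by (simp_all add: admissible_step_def Let_def)
      then have "cinner (T ?r) (u j) = 0" "cinner ?r (T (u j)) = 0"
        using cinner_commute[of "T ?r" "u j"] cinner_commute[of ?r "T (u j)"] by simp_all
      then show ?thesis
        using j orth by simp
    qed
    ultimately have "admissible_step T l K A \<gamma> target u n x"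
      using True x by (simp add: admissible_step_def)
    then show ?thesis ..
  qed
qed

lemma admissible_sequence_exists:
  assumes "\<And>n u. (\<And>j. j < n \<Longrightarrow> admissible_step T l K A \<gamma> target u j (u j)) \<Longrightarrow>
    \<exists>x. admissible_step T l K A \<gamma> target u n x"
  shows "\<exists>u. \<forall>n. admissible_step T l K A \<gamma> target u n (u n)"
proof (rule dependent_wellorder_choice)
  fix n x and f g :: "nat \<Rightarrow> 'a"
  assume "\<And>j. j < n \<Longrightarrow> f j = g j"
  then show "admissible_step T l K A \<gamma> target f n x = admissible_step T l K A \<gamma> target g n x"
    using residual_cong[of n f g] by (simp add: admissible_step_def)
qed (fact assms)

text \<open>Indices in \<open>A\<close> with target \<open>y\<close> shrink the squared residual by the factor \<open>1 - \<gamma> n \<le> exp (- \<gamma> n)\<close>;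
  at all other indices it does not grow.\<close>

lemma residual_le_exp:
  assumes adm: "\<And>n. admissible_step T l K A \<gamma> target u n (u n)" and \<gamma>: "\<And>n. 0 \<le> \<gamma> n"
  shows "(norm (residual u N y))\<^sup>2 \<le>
    (norm y)\<^sup>2 * exp (- (\<Sum>n<N. if n \<in> A \<and> target n = y then \<gamma> n else 0))"
proof (induction N)
  case 0
  show ?case by (simp add: residual_def)
next
  case (Suc N)
  let ?r = "residual u N y"
  let ?c = "if N \<in> A \<and> target N = y then \<gamma> N else 0"
  have "?c * (norm ?r)\<^sup>2 \<le> (cmod (cinner ?r (u N)))\<^sup>2"
    using adm[of N] by (auto simp: admissible_step_def Let_def)
  moreover have "(norm (residual u (Suc N) y))\<^sup>2 = (norm ?r)\<^sup>2 - (cmod (cinner ?r (u N)))\<^sup>2"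
    using adm[of N] by (intro norm_residual_Suc) (simp_all add: admissible_step_def)
  ultimately have "(norm (residual u (Suc N) y))\<^sup>2 \<le> (norm ?r)\<^sup>2 * (1 - ?c)"
    by (simp add: algebra_simps)
  also have "\<dots> \<le> (norm ?r)\<^sup>2 * exp (- ?c)"
    using exp_ge_add_one_self[of "- ?c"] by (intro mult_left_mono) auto
  also have "\<dots> \<le> (norm y)\<^sup>2 * exp (- (\<Sum>n<N. if n \<in> A \<and> target n = y then \<gamma> n else 0)) * exp (- ?c)"
    using Suc.IH by (intro mult_right_mono) auto
  finally show ?case
    by (simp add: mult.assoc flip: exp_add)
qed

lemma in_closure_cspan:
  assumes adm: "\<And>n. admissible_step T l K A \<gamma> target u n (u n)" and \<gamma>: "\<And>n. 0 \<le> \<gamma> n"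
    and unbounded: "\<And>B. \<exists>N. B \<le> (\<Sum>n<N. if n \<in> A \<and> target n = y then \<gamma> n else 0)"
  shows "y \<in> closure (cspan (range u))"
  unfolding closure_approachable
proof (intro allI impI)
  fix \<epsilon> :: real
  assume "\<epsilon> > 0"
  define B where "B = ln (((norm y)\<^sup>2 + 1) / \<epsilon>\<^sup>2)"
  have pos: "((norm y)\<^sup>2 + 1) / \<epsilon>\<^sup>2 > 0"
    using \<open>\<epsilon> > 0\<close> by (simp add: add_nonneg_pos)
  then have "exp (- B) = \<epsilon>\<^sup>2 / ((norm y)\<^sup>2 + 1)"
    by (simp add: B_def exp_minus)
  then have small: "(norm y)\<^sup>2 * exp (- B) < \<epsilon>\<^sup>2"
    using \<open>\<epsilon> > 0\<close> by (simp add: pos_divide_less_eq add_nonneg_pos)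
  obtain N where N: "B \<le> (\<Sum>n<N. if n \<in> A \<and> target n = y then \<gamma> n else 0)"
    using unbounded by blast
  have "(norm (residual u N y))\<^sup>2 \<le>
      (norm y)\<^sup>2 * exp (- (\<Sum>n<N. if n \<in> A \<and> target n = y then \<gamma> n else 0))"
    by (rule residual_le_exp[OF adm \<gamma>])
  also have "\<dots> \<le> (norm y)\<^sup>2 * exp (- B)"
    using N by (intro mult_left_mono) auto
  finally have "(norm (residual u N y))\<^sup>2 \<le> (norm y)\<^sup>2 * exp (- B)" .
  with small have "norm (residual u N y) < \<epsilon>"
    using \<open>\<epsilon> > 0\<close> by (intro power2_less_imp_less[of _ \<epsilon>]) auto
  then show "\<exists>x\<in>cspan (range u). dist x y < \<epsilon>"
    by (intro bexI[OF _ diff_residual_in_cspan[of y u N]]) (simp add: dist_norm)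
qed

theorem theorem2p2:
  fixes T :: "'a :: complex_hilbert \<Rightarrow> 'a"
    and l :: "nat \<Rightarrow> complex"
    and K :: nat
  assumes separable: "\<exists>D :: 'a set. countable D \<and> closure D = UNIV"
    and infinite_dim: "\<not> (\<exists>B :: 'a set. finite B \<and> cspan B = UNIV)"
    and T: "bounded_clinear T"
    and l_interior: "\<And>n. l n \<in> interior (ess_num_range T)"
    and sum_infinite:
      "filterlim (\<lambda>N. \<Sum>n<N. infdist (l n) (frontier (ess_num_range T))) at_top sequentially"
    and K: "K \<ge> 1"
  shows "\<exists>u :: nat \<Rightarrow> 'a. orthonormal_basis_seq u \<and>
    (\<forall>n. cinner (T (u n)) (u n) = l n) \<and>
    (\<forall>n j. 1 \<le> \<bar>int n - int j\<bar> \<and> \<bar>int n - int j\<bar> \<le> int K \<longrightarrow> cinner (T (u n)) (u j) = 0)"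
proof -
  obtain D :: "'a set" where D: "countable D" "closure D = UNIV"
    using separable by blast
  obtain M where "\<And>x. norm (T x) \<le> norm x * M" and M0: "M > 0"
    using bounded_linear.pos_bounded[OF bounded_clinearD(1)[OF T]] by blast
  then have M: "norm (T x) \<le> M * norm x" for x
    by (simp add: mult.commute)
  let ?d = "\<lambda>n. infdist (l n) (frontier (ess_num_range T))"
  define \<gamma> where "\<gamma> n = ?d n / (8 * M)" for n
  have \<gamma>0: "0 \<le> \<gamma> n" for n
    using M0 by (simp add: \<gamma>_def infdist_nonneg)
  have \<gamma>1: "\<gamma> n \<le> 1 / 4" for n
    using M0 infdist_frontier_ess_num_range_le[OF M l_interior[of n]] by (simp add: \<gamma>_def field_simps)
  have "\<exists>N. B \<le> (\<Sum>n<N. \<gamma> n)" for B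
  proof -
    obtain N where "B * (8 * M) \<le> (\<Sum>n<N. ?d n)"
      using sum_infinite unfolding filterlim_at_top eventually_sequentially by blast
    then have "B \<le> (\<Sum>n<N. ?d n) / (8 * M)"
      using M0 by (simp add: field_simps)
    then show ?thesis
      by (auto simp: \<gamma>_def sum_divide_distrib)
  qed
  from spaced_divergent_schedule[OF \<gamma>0 \<gamma>1 this, of K] obtain A and s :: "nat \<Rightarrow> nat"
    where spaced: "\<And>i j. i \<in> A \<Longrightarrow> j \<in> A \<Longrightarrow> i < j \<Longrightarrow> i + K < j"
      and s: "\<And>n. n \<notin> A \<Longrightarrow> s (Suc n) = s n"
      and unbounded: "\<And>m B. \<exists>N. B \<le> (\<Sum>n<N. if n \<in> A \<and> s n = m then \<gamma> n else 0)"
    by metis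
  define target where "target n = from_nat_into D (s n)" for n
  have target: "target (Suc n) = target n" if "n \<notin> A" for n
    using s[OF that] by (simp add: target_def)
  have "\<exists>u. \<forall>n. admissible_step T l K A \<gamma> target u n (u n)"
  proof (rule admissible_sequence_exists)
    fix n u
    assume "\<And>j. j < n \<Longrightarrow> admissible_step T l K A \<gamma> target u j (u j)"
    with T M M0 l_interior \<gamma>_def spaced target show "\<exists>x. admissible_step T l K A \<gamma> target u n x"
      by (rule admissible_extension)
  qed
  then obtain u where u: "\<And>n. admissible_step T l K A \<gamma> target u n (u n)"
    by blast
  have "orthonormal_seq u"
    unfolding orthonormal_seq_def
  proof (intro allI)
    fix m n
    show "cinner (u m) (u n) = (if m = n then 1 else 0)"
      using admissible_orthonormal[OF u, of m "Suc (max m n)" n] by simp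
  qed
  moreover have "closure (cspan (range u)) = UNIV"
  proof -
    have "D \<subseteq> closure (cspan (range u))"
    proof
      fix y
      assume "y \<in> D"
      then obtain m where m: "from_nat_into D m = y"
        using from_nat_into_surj[OF D(1)] by blast
      show "y \<in> closure (cspan (range u))"
      proof (rule in_closure_cspan[OF u \<gamma>0])
        fix B
        obtain N where "B \<le> (\<Sum>n<N. if n \<in> A \<and> s n = m then \<gamma> n else 0)"
          using unbounded by blast
        \<comment> \<open>The same \<open>y\<close> may also occur under other labels, which only helps.\<close>
        also have "\<dots> \<le> (\<Sum>n<N. if n \<in> A \<and> target n = y then \<gamma> n else 0)"
          using \<gamma>0 m by (intro sum_mono) (auto simp: target_def)
        finally show "\<exists>N. B \<le> (\<Sum>n<N. if n \<in> A \<and> target n = y then \<gamma> n else 0)"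
          by blast
      qed
    qed
    then have "closure D \<subseteq> closure (cspan (range u))"
      by (rule closure_minimal) simp
    with D(2) show ?thesis
      by blast
  qed
  moreover have "cinner (T (u n)) (u n) = l n" for n
    using u[of n] by (simp add: admissible_step_def)
  moreover have "cinner (T (u n)) (u j) = 0" if "1 \<le> \<bar>int n - int j\<bar>" "\<bar>int n - int j\<bar> \<le> int K" for n j
  proof (cases "j < n")
    case True
    with that have "n \<le> j + K" by simp
    with True u[of n] show ?thesis
      by (simp add: admissible_step_def)
  next
    case False
    with that have "n < j" "j \<le> n + K" by simp_all
    with u[of j] have "cinner (u j) (T (u n)) = 0"
      by (simp add: admissible_step_def)
    then show ?thesis
      using cinner_commute[of "T (u n)" "u j"] by simp
  qed
  ultimately show ?thesis
    unfolding orthonormal_basis_seq_def by blast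
qed

end
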